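(* Let $t \ge r \ge 1$ and $n \ge 1$ be integers, and let $G$ be a finite $n$-dimensional grid graph (the Cartesian product of $n$ finite paths) with vertex set $V$. Then $$\gamma_{t,r}(G) \geq \frac{r|V|}{C_{t, r}(\mathbb{Z}^n)}.$$
   Context: For a graph $G=(V,E)$ and $D \subseteq V$, the reception at $v$ is $\sum_{u \in D,\ \mathrm{dist}(u,v)\le t}(t-\mathrm{dist}(u,v))$; $D$ is $(t,r)$ broadcast dominating if every vertex has reception at least $r$, and $\gamma_{t,r}(G)$ is the minimum size of such a $D$. In the infinite grid $\mathbb{Z}^n$ (distance $\sum_i|x_i-y_i|$), the unwasted reception a broadcast at $u$ gives to $v$ is $\min(\max(t-\mathrm{dist}(u,v),0), r)$, and $C_{t,r}(\mathbb{Z}^n)$ is the sum over all $v \in \mathbb{Z}^n$ of the unwasted reception given by a broadcast at the origin; equivalently $C_{t,r}(\mathbb{Z}^n) = \sum_{d=t-r+1}^{t-1}(t-d)|S_n(d)| + r\sum_{d=1}^{t-r}|S_n(d)| + r$, where $S_n(d)$ is the set of points of $\mathbb{Z}^n$ at distance exactly $d$ from the origin. *)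

theory Defs
  imports "HOL-Analysis.Infinite_Sum" "HOL-Library.Extended_Nat" "Graph_Theory.Arc_Walk"
begin

text \<open>Undirected graphs are symmetric digraphs, as in the locale \<^locale>\<open>graph\<close>.
  The value is \<open>\<infinity>\<close> when no walk joins the two vertices.\<close>

definition graph_dist :: "('a, 'b) pre_digraph \<Rightarrow> 'a \<Rightarrow> 'a \<Rightarrow> enat" where
  "graph_dist G u v = (INF p \<in> {p. pre_digraph.awalk G u p v}. enat (length p))"

definition reception :: "('a, 'b) pre_digraph \<Rightarrow> nat \<Rightarrow> 'a set \<Rightarrow> 'a \<Rightarrow> nat" where
  "reception G t D v =
     (\<Sum>u \<in> {u \<in> D. graph_dist G u v \<le> enat t}. t - the_enat (graph_dist G u v))"

definition broadcast_dominating :: "('a, 'b) pre_digraph \<Rightarrow> nat \<Rightarrow> nat \<Rightarrow> 'a set \<Rightarrow> bool" where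
  "broadcast_dominating G t r D \<longleftrightarrow> D \<subseteq> verts G \<and> (\<forall>v \<in> verts G. reception G t D v \<ge> r)"

definition broadcast_domination_number :: "('a, 'b) pre_digraph \<Rightarrow> nat \<Rightarrow> nat \<Rightarrow> nat" where
  "broadcast_domination_number G t r =
     (LEAST k. \<exists>D. finite D \<and> broadcast_dominating G t r D \<and> card D = k)"

definition path_graph :: "nat \<Rightarrow> (nat, nat \<times> nat) pre_digraph" where
  "path_graph m =
     \<lparr> verts = {..<m},
       arcs = {(x, y). x < m \<and> y < m \<and> (y = Suc x \<or> x = Suc y)},
       tail = fst, head = snd \<rparr>"

definition cartesian_product ::
    "nat \<Rightarrow> (nat \<Rightarrow> ('a, 'b) pre_digraph) \<Rightarrow> (nat \<Rightarrow> 'a, (nat \<Rightarrow> 'a) \<times> (nat \<Rightarrow> 'a)) pre_digraph" where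
  "cartesian_product n G =
     (let V = (\<Pi>\<^sub>E i \<in> {..<n}. verts (G i)) in
     \<lparr> verts = V,
       arcs = {(x, y). x \<in> V \<and> y \<in> V \<and>
         (\<exists>i<n. (x i, y i) \<in> arcs_ends (G i) \<and> (\<forall>j<n. j \<noteq> i \<longrightarrow> x j = y j))},
       tail = fst, head = snd \<rparr>)"

definition grid_graph :: "nat \<Rightarrow> (nat \<Rightarrow> nat) \<Rightarrow> (nat \<Rightarrow> nat, (nat \<Rightarrow> nat) \<times> (nat \<Rightarrow> nat)) pre_digraph" where
  "grid_graph n m = cartesian_product n (\<lambda>i. path_graph (m i))"

lemma graph_grid_graph: "graph (grid_graph n m)"
proof -
  let ?V = "\<Pi>\<^sub>E i \<in> {..<n}. {..<m i}"
  let ?G = "grid_graph n m"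
  have V: "verts ?G = ?V"
    by (simp add: grid_graph_def cartesian_product_def path_graph_def Let_def)
  have fin: "finite ?V" by (intro finite_PiE) auto
  have ends: "arcs_ends (path_graph k) = arcs (path_graph k)" for k
    by (auto simp: arcs_ends_def arc_to_ends_def path_graph_def)
  have A: "arcs ?G = {(x, y). x \<in> ?V \<and> y \<in> ?V \<and>
         (\<exists>i<n. (x i < m i \<and> y i < m i \<and> (y i = Suc (x i) \<or> x i = Suc (y i)))
           \<and> (\<forall>j<n. j \<noteq> i \<longrightarrow> x j = y j))}"
    unfolding grid_graph_def cartesian_product_def Let_def ends
    by (simp add: path_graph_def)
  have th: "tail ?G = fst" "head ?G = snd"
    by (simp_all add: grid_graph_def cartesian_product_def Let_def)
  have sub: "arcs ?G \<subseteq> ?V \<times> ?V" unfolding A by blast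
  then have finA: "finite (arcs ?G)" using fin finite_subset by blast
  have ends_G: "arcs_ends ?G = arcs ?G"
    by (auto simp: arcs_ends_def arc_to_ends_def th)
  have loopfree: "x \<noteq> y" if "(x, y) \<in> arcs ?G" for x y
  proof -
    from that obtain i where "y i = Suc (x i) \<or> x i = Suc (y i)" unfolding A by blast
    then show ?thesis by auto
  qed
  show ?thesis
  proof
    fix e assume e: "e \<in> arcs ?G"
    then have "e \<in> ?V \<times> ?V" using sub by blast
    then show "tail ?G e \<in> verts ?G" "head ?G e \<in> verts ?G"
      unfolding V th by (simp_all add: mem_Times_iff)
    show "tail ?G e \<noteq> head ?G e"
      using e loopfree[of "fst e" "snd e"] unfolding th by simp
  next
    show "finite (verts ?G)" using fin V by simp
    show "finite (arcs ?G)" by (rule finA)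
    show "symmetric ?G" unfolding symmetric_def ends_G
    proof (rule symI)
      fix x y assume "(x, y) \<in> arcs ?G"
      then obtain i where "x \<in> ?V" "y \<in> ?V" "i < n" "x i < m i" "y i < m i"
        "y i = Suc (x i) \<or> x i = Suc (y i)" "\<forall>j<n. j \<noteq> i \<longrightarrow> x j = y j"
        unfolding A by blast
      then show "(y, x) \<in> arcs ?G"
        unfolding A mem_Collect_eq case_prod_conv by metis
    qed
  next
    fix e f assume "arc_to_ends ?G e = arc_to_ends ?G f"
    then show "e = f" by (simp add: arc_to_ends_def th prod_eq_iff)
  qed
qed

definition int_lattice :: "nat \<Rightarrow> (nat \<Rightarrow> int) set" where
  "int_lattice n = ({..<n} \<rightarrow>\<^sub>E UNIV)"

definition lattice_origin :: "nat \<Rightarrow> nat \<Rightarrow> int" where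
  "lattice_origin n = (\<lambda>i \<in> {..<n}. 0)"

definition lattice_dist :: "nat \<Rightarrow> (nat \<Rightarrow> int) \<Rightarrow> (nat \<Rightarrow> int) \<Rightarrow> int" where
  "lattice_dist n x y = (\<Sum>i<n. \<bar>x i - y i\<bar>)"

definition unwasted_reception :: "nat \<Rightarrow> nat \<Rightarrow> nat \<Rightarrow> (nat \<Rightarrow> int) \<Rightarrow> (nat \<Rightarrow> int) \<Rightarrow> int" where
  "unwasted_reception n t r u v = min (max (int t - lattice_dist n u v) 0) (int r)"

definition total_unwasted_reception :: "nat \<Rightarrow> nat \<Rightarrow> nat \<Rightarrow> real" where
  "total_unwasted_reception n t r =
     (\<Sum>\<^sub>\<infinity>v \<in> int_lattice n. real_of_int (unwasted_reception n t r (lattice_origin n) v))"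

text \<open>The sum has finite support, so it is not a default value of \<^const>\<open>infsum\<close>.\<close>

lemma summable_unwasted_reception:
  "(\<lambda>v. real_of_int (unwasted_reception n t r (lattice_origin n) v)) summable_on int_lattice n"
proof (rule finite_nonzero_values_imp_summable_on, rule finite_subset)
  show "finite ({..<n} \<rightarrow>\<^sub>E {- int t..int t})" by (intro finite_PiE) auto
  show "{v \<in> int_lattice n. real_of_int (unwasted_reception n t r (lattice_origin n) v) \<noteq> 0}
      \<subseteq> ({..<n} \<rightarrow>\<^sub>E {- int t..int t})"
  proof
    fix v assume v: "v \<in> {v \<in> int_lattice n.
      real_of_int (unwasted_reception n t r (lattice_origin n) v) \<noteq> 0}"
    then have d: "lattice_dist n (lattice_origin n) v < int t"
      by (auto simp: unwasted_reception_def)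
    have "\<bar>v i\<bar> \<le> int t" if "i < n" for i
    proof -
      have "\<bar>lattice_origin n i - v i\<bar> \<le> lattice_dist n (lattice_origin n) v"
        unfolding lattice_dist_def using that by (intro member_le_sum) auto
      with d that show ?thesis by (simp add: lattice_origin_def)
    qed
    then show "v \<in> ({..<n} \<rightarrow>\<^sub>E {- int t..int t})"
      using v by (auto simp: int_lattice_def PiE_iff abs_le_iff minus_le_iff)
  qed
qed

end

theory Submission
  imports Defs
begin

text \<open>Double counting. A grid walk is never shorter than the taxicab distance of its ends, so the
  reception in \<open>G\<close> is bounded by reception in the lattice, and capping every contribution
  at \<open>r\<close> does not push a sum that is at least \<open>r\<close> below \<open>r\<close>. Hence each of the \<open>|V|\<close> vertices receives
  at least \<open>r\<close> units of unwasted reception from a dominating set \<open>D\<close>, whereas each member of \<open>D\<close>,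
  translated to the origin, hands out at most \<open>C\<close> units in total.\<close>

text \<open>\<open>restrict\<close> makes the image extensional, as membership in
  \<open>int_lattice n\<close> demands.\<close>

definition lattice_embed :: "nat \<Rightarrow> (nat \<Rightarrow> nat) \<Rightarrow> nat \<Rightarrow> int" where
  "lattice_embed n x = (\<lambda>i \<in> {..<n}. int (x i))"

lemma verts_grid_graph: "verts (grid_graph n m) = (\<Pi>\<^sub>E i \<in> {..<n}. {..<m i})"
  by (simp add: grid_graph_def cartesian_product_def path_graph_def Let_def)

lemma finite_verts_grid_graph: "finite (verts (grid_graph n m))"
  unfolding verts_grid_graph by (intro finite_PiE) auto

lemma lattice_dist_triangle: "lattice_dist n x z \<le> lattice_dist n x y + lattice_dist n y z"
  unfolding lattice_dist_def sum.distrib[symmetric] by (rule sum_mono) linarith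

lemma lattice_dist_arc_grid_graph:
  assumes "e \<in> arcs (grid_graph n m)"
  shows "lattice_dist n (lattice_embed n (tail (grid_graph n m) e))
           (lattice_embed n (head (grid_graph n m) e)) = 1"
proof -
  obtain x y where e: "e = (x, y)" by (cases e)
  from assms obtain i where i: "i < n" "y i = Suc (x i) \<or> x i = Suc (y i)"
      "\<forall>j<n. j \<noteq> i \<longrightarrow> x j = y j"
    by (auto simp: e grid_graph_def cartesian_product_def Let_def path_graph_def
        arcs_ends_def arc_to_ends_def)
  have "lattice_dist n (lattice_embed n x) (lattice_embed n y) = (\<Sum>j<n. if j = i then 1 else 0)"
    unfolding lattice_dist_def
    by (rule sum.cong) (use i in \<open>auto simp: lattice_embed_def\<close>)
  also have "\<dots> = 1" using i(1) by simp
  finally show ?thesis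
    by (simp add: e grid_graph_def cartesian_product_def Let_def)
qed

text \<open>Every arc moves exactly one coordinate by one, so the triangle inequality gives the
  bound by induction along the walk. With \<open>cas\<close> in place of \<open>awalk\<close>, the
  induction carries no side condition that the start is a vertex.\<close>

lemma lattice_dist_le_length_cas:
  assumes "set p \<subseteq> arcs (grid_graph n m)" and "pre_digraph.cas (grid_graph n m) u p v"
  shows "lattice_dist n (lattice_embed n u) (lattice_embed n v) \<le> int (length p)"
  using assms
proof (induction p arbitrary: u)
  case Nil
  then show ?case by (simp add: pre_digraph.cas.simps lattice_dist_def)
next
  case (Cons e p)
  let ?w = "head (grid_graph n m) e"
  have u: "tail (grid_graph n m) e = u" and "pre_digraph.cas (grid_graph n m) ?w p v"
    using Cons.prems(2) by (simp_all add: pre_digraph.cas.simps)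
  then have "lattice_dist n (lattice_embed n ?w) (lattice_embed n v) \<le> int (length p)"
    using Cons by simp
  moreover have "lattice_dist n (lattice_embed n u) (lattice_embed n ?w) = 1"
    using lattice_dist_arc_grid_graph[of e n m] Cons.prems(1) u by simp
  ultimately show ?case
    using lattice_dist_triangle[of n "lattice_embed n u" "lattice_embed n v" "lattice_embed n ?w"]
    by simp
qed

text \<open>The bound holds for each walk and so passes to the infimum, also when that is infinite.
  This is the useful direction: a larger graph distance can only lower the reception.\<close>

lemma lattice_dist_le_graph_dist:
  "enat (nat (lattice_dist n (lattice_embed n u) (lattice_embed n v)))
     \<le> graph_dist (grid_graph n m) u v"
  unfolding graph_dist_def
proof (rule INF_greatest)
  fix p assume "p \<in> {p. pre_digraph.awalk (grid_graph n m) u p v}"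
  then have "lattice_dist n (lattice_embed n u) (lattice_embed n v) \<le> int (length p)"
    by (auto simp: pre_digraph.awalk_def intro: lattice_dist_le_length_cas)
  then show "enat (nat (lattice_dist n (lattice_embed n u) (lattice_embed n v))) \<le> enat (length p)"
    by simp
qed

lemma reception_grid_graph_le:
  assumes "finite D"
  shows "int (reception (grid_graph n m) t D v)
    \<le> (\<Sum>u\<in>D. max (int t - lattice_dist n (lattice_embed n u) (lattice_embed n v)) 0)"
proof -
  let ?G = "grid_graph n m"
  let ?L = "\<lambda>u. lattice_dist n (lattice_embed n u) (lattice_embed n v)"
  have "int (reception ?G t D v)
      = (\<Sum>u \<in> {u \<in> D. graph_dist ?G u v \<le> enat t}. int (t - the_enat (graph_dist ?G u v)))"
    by (simp add: reception_def)
  also have "\<dots> \<le> (\<Sum>u \<in> {u \<in> D. graph_dist ?G u v \<le> enat t}. max (int t - ?L u) 0)"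
  proof (rule sum_mono)
    fix u assume "u \<in> {u \<in> D. graph_dist ?G u v \<le> enat t}"
    \<comment> \<open>The cutoff at \<open>t\<close> makes the distance finite, so
      \<open>the_enat\<close> returns its true value.\<close>
    then obtain k where k: "graph_dist ?G u v = enat k"
      by (cases "graph_dist ?G u v") auto
    have "?L u \<le> int k"
      using lattice_dist_le_graph_dist[of n u v m] by (simp add: k)
    then show "int (t - the_enat (graph_dist ?G u v)) \<le> max (int t - ?L u) 0"
      by (simp add: k)
  qed
  \<comment> \<open>Sources beyond the cutoff add only nonnegative terms.\<close>
  also have "\<dots> \<le> (\<Sum>u\<in>D. max (int t - ?L u) 0)"
    using assms by (intro sum_mono2) auto
  finally show ?thesis .
qed

text \<open>If some term reaches \<open>c\<close>, its capped value alone is \<open>c\<close>;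
  otherwise the cap changes no term and the sum stays the same.\<close>

lemma sum_min_ge:
  fixes f :: "'a \<Rightarrow> 'b :: linordered_idom"
  assumes "finite D" and "\<And>u. u \<in> D \<Longrightarrow> 0 \<le> f u" and "0 \<le> c" and "c \<le> sum f D"
  shows "c \<le> (\<Sum>u\<in>D. min (f u) c)"
proof (cases "\<exists>u\<in>D. c \<le> f u")
  case True
  then obtain u where u: "u \<in> D" "c \<le> f u" by blast
  have "min (f u) c \<le> (\<Sum>u\<in>D. min (f u) c)"
    using assms u by (intro member_le_sum) auto
  with u show ?thesis by simp
next
  case False
  then have "(\<Sum>u\<in>D. min (f u) c) = sum f D"
    by (intro sum.cong) auto
  with assms show ?thesis by simp
qed

lemma unwasted_reception_nonneg: "0 \<le> unwasted_reception n t r u v"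
  by (simp add: unwasted_reception_def)

lemma total_unwasted_reception_nonneg: "0 \<le> total_unwasted_reception n t r"
  unfolding total_unwasted_reception_def
  by (intro infsum_nonneg) (simp add: unwasted_reception_nonneg)

lemma broadcast_dominating_unwasted_reception:
  assumes "finite D" and "broadcast_dominating (grid_graph n m) t r D"
    and "v \<in> verts (grid_graph n m)"
  shows "int r \<le> (\<Sum>u\<in>D. unwasted_reception n t r (lattice_embed n u) (lattice_embed n v))"
  unfolding unwasted_reception_def
\<comment> \<open>Unfolded, unwasted reception is the contribution \<open>max ... 0\<close> capped
  at \<open>r\<close>, so the rule applies with cap \<open>int r\<close>.\<close>
proof (rule sum_min_ge)
  have "int r \<le> int (reception (grid_graph n m) t D v)"
    using assms(2,3) by (simp add: broadcast_dominating_def)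
  also note reception_grid_graph_le[OF assms(1)]
  finally show "int r
      \<le> (\<Sum>u\<in>D. max (int t - lattice_dist n (lattice_embed n u) (lattice_embed n v)) 0)" .
qed (use assms(1) in auto)

text \<open>Translation by \<open>-u\<close> preserves distances and moves the source to the origin.
  Being injective on \<open>X\<close>, it turns the sum into a finite partial sum of the nonnegative
  series that defines the total.\<close>

lemma sum_unwasted_reception_le_total:
  assumes "finite X" and "X \<subseteq> int_lattice n"
  shows "(\<Sum>x\<in>X. real_of_int (unwasted_reception n t r u x)) \<le> total_unwasted_reception n t r"
proof -
  define g where "g x = (\<lambda>i \<in> {..<n}. x i - u i)" for x :: "nat \<Rightarrow> int"
  have inj: "inj_on g X"
  proof (rule inj_onI)
    fix x y assume "x \<in> X" "y \<in> X" and eq: "g x = g y"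
    then have ext: "x \<in> extensional {..<n}" "y \<in> extensional {..<n}"
      using assms(2) by (auto simp: int_lattice_def PiE_def)
    show "x = y"
    proof (rule extensionalityI[OF ext])
      fix i assume "i \<in> {..<n}"
      \<comment> \<open>\<open>g\<close> fixes only the coordinates below \<open>n\<close>;
        extensionality settles the others.\<close>
      then show "x i = y i" using fun_cong[OF eq, of i] by (simp add: g_def)
    qed
  qed
  have "unwasted_reception n t r u x = unwasted_reception n t r (lattice_origin n) (g x)" for x
  proof -
    have "lattice_dist n u x = lattice_dist n (lattice_origin n) (g x)"
      unfolding lattice_dist_def by (rule sum.cong) (auto simp: g_def lattice_origin_def)
    then show ?thesis by (simp add: unwasted_reception_def)
  qed
  then have "(\<Sum>x\<in>X. real_of_int (unwasted_reception n t r u x))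
      = (\<Sum>x\<in>g ` X. real_of_int (unwasted_reception n t r (lattice_origin n) x))"
    by (simp add: sum.reindex[OF inj])
  also have "\<dots> \<le> total_unwasted_reception n t r"
    unfolding total_unwasted_reception_def
    using assms(1) summable_unwasted_reception
    by (intro finite_sum_le_infsum)
      (auto simp: unwasted_reception_nonneg g_def int_lattice_def split: if_splits)
  finally show ?thesis .
qed

lemma inj_on_lattice_embed: "inj_on (lattice_embed n) (verts (grid_graph n m))"
proof (rule inj_onI)
  fix x y assume "x \<in> verts (grid_graph n m)" "y \<in> verts (grid_graph n m)"
    and eq: "lattice_embed n x = lattice_embed n y"
  then have ext: "x \<in> extensional {..<n}" "y \<in> extensional {..<n}"
    by (auto simp: verts_grid_graph PiE_def)
  show "x = y"
  proof (rule extensionalityI[OF ext])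
    fix i assume "i \<in> {..<n}"
    then show "x i = y i" using fun_cong[OF eq, of i] by (simp add: lattice_embed_def)
  qed
qed

lemma broadcast_dominating_card_ge:
  assumes "finite D" and "broadcast_dominating (grid_graph n m) t r D"
  shows "real r * real (card (verts (grid_graph n m)))
    \<le> real (card D) * total_unwasted_reception n t r"
proof -
  let ?V = "verts (grid_graph n m)"
  let ?w = "\<lambda>u v. real_of_int (unwasted_reception n t r (lattice_embed n u) (lattice_embed n v))"
  have "real r * real (card ?V) = (\<Sum>v\<in>?V. real r)"
    by simp
  also have "\<dots> \<le> (\<Sum>v\<in>?V. \<Sum>u\<in>D. ?w u v)"
  proof (rule sum_mono)
    fix v assume "v \<in> ?V"
    from broadcast_dominating_unwasted_reception[OF assms this]
    have "real_of_int (int r) \<le> real_of_int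
        (\<Sum>u\<in>D. unwasted_reception n t r (lattice_embed n u) (lattice_embed n v))"
      by (simp only: of_int_le_iff)
    then show "real r \<le> (\<Sum>u\<in>D. ?w u v)" by simp
  qed
  \<comment> \<open>From counting by receiver to counting by source.\<close>
  also have "\<dots> = (\<Sum>u\<in>D. \<Sum>v\<in>?V. ?w u v)"
    by (rule sum.swap)
  also have "\<dots> \<le> (\<Sum>u\<in>D. total_unwasted_reception n t r)"
  proof (rule sum_mono)
    fix u
    \<comment> \<open>Injectivity of the embedding ensures that no lattice point is counted
      twice.\<close>
    have "(\<Sum>v\<in>?V. ?w u v) = (\<Sum>x\<in>lattice_embed n ` ?V.
        real_of_int (unwasted_reception n t r (lattice_embed n u) x))"
      by (simp add: sum.reindex[OF inj_on_lattice_embed])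
    also have "\<dots> \<le> total_unwasted_reception n t r"
      by (rule sum_unwasted_reception_le_total)
        (auto simp: finite_verts_grid_graph lattice_embed_def int_lattice_def split: if_splits)
    finally show "(\<Sum>v\<in>?V. ?w u v) \<le> total_unwasted_reception n t r" .
  qed
  finally show ?thesis by simp
qed

lemma graph_dist_self:
  assumes "v \<in> verts G"
  shows "graph_dist G v v = 0"
proof -
  have "pre_digraph.awalk G v [] v"
    using assms by (simp add: pre_digraph.awalk_def pre_digraph.cas.simps)
  then have "graph_dist G v v \<le> enat (length ([] :: 'b list))"
    unfolding graph_dist_def by (intro INF_lower) simp
  then show ?thesis by (simp add: zero_enat_def[symmetric])
qed

text \<open>Each vertex is at distance 0 from itself and so receives at least \<open>t\<close> from
  its own broadcast. This supplies a dominating set for the minimum to range over.\<close>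

lemma broadcast_dominating_verts:
  assumes "finite (verts G)" and "r \<le> t"
  shows "broadcast_dominating G t r (verts G)"
  unfolding broadcast_dominating_def
proof (intro conjI ballI subset_refl)
  fix v assume v: "v \<in> verts G"
  have "t - the_enat (graph_dist G v v) \<le> reception G t (verts G) v"
    unfolding reception_def
    by (rule member_le_sum) (use assms(1) v in \<open>auto simp: graph_dist_self\<close>)
  moreover have "the_enat (graph_dist G v v) = 0"
    by (simp add: graph_dist_self[OF v] zero_enat_def)
  ultimately show "r \<le> reception G t (verts G) v" using assms(2) by simp
qed

theorem theorem11:
  fixes n t r :: nat and m :: "nat \<Rightarrow> nat"
  assumes "1 \<le> r" and "r \<le> t" and "1 \<le> n"
    and "\<And>i. i < n \<Longrightarrow> 1 \<le> m i"
  shows "real (broadcast_domination_number (grid_graph n m) t r)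
    \<ge> real r * real (card (verts (grid_graph n m))) / total_unwasted_reception n t r"
proof -
  let ?G = "grid_graph n m"
  have "\<exists>D. finite D \<and> broadcast_dominating ?G t r D \<and> card D = card (verts ?G)"
    using broadcast_dominating_verts[OF finite_verts_grid_graph assms(2)] finite_verts_grid_graph
    by blast
  \<comment> \<open>\<open>LEAST\<close> is meaningful only once some size is attained; then the
    minimum is the size of an actual dominating set.\<close>
  then have "\<exists>D. finite D \<and> broadcast_dominating ?G t r D
      \<and> card D = broadcast_domination_number ?G t r"
    unfolding broadcast_domination_number_def by (rule LeastI)
  then have "real r * real (card (verts ?G))
      \<le> real (broadcast_domination_number ?G t r) * total_unwasted_reception n t r"
    using broadcast_dominating_card_ge by metis
  then show ?thesis
    using total_unwasted_reception_nonneg[of n t r]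
    \<comment> \<open>The split replaces a proof that the total is positive: at total 0 the quotient
      is 0 by the HOL convention, and the claim is trivial.\<close>
    by (cases "total_unwasted_reception n t r = 0") (auto simp: pos_divide_le_eq)
qed

end
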